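(* For every $C_0>0$ there is a constant $C>0$, depending only on $C_0$, such that the following holds for every positive integer $N$ and every measure $\mu$ on $Q=[0,1]^2$ (at scale $N$). If $\mu$ satisfies the box condition $$\sum_{R\in\mathcal D_N,\ R\subset R_0}\mu(R)^2\le C_0\,\mu(R_0)\qquad\text{for all } R_0\in\mathcal D_N,$$ then for every rectangle $R=H\times V\in\mathcal D_N$ with $|H|<1$ and $|V|<1$, $$\mu(R)\le \frac{C}{\log_2\frac1{|H|}\cdot\log_2\frac1{|V|}}.$$ In particular, $\mu(\omega)\le C N^{-2}$ for every dyadic square $\omega\subset Q$ of size $2^{-N}\times2^{-N}$.
   Context: Let $Q=[0,1]^2$ be the unit square and let $N$ be a positive integer. $\mathcal D_N$ denotes the family of all dyadic rectangles $R=H\times V\subset Q$, where $H,V$ are dyadic subintervals of the unit interval (half-open, of the form $[j2^{-n},(j+1)2^{-n})$) of length at least $2^{-N}$; $|H|,|V|$ denote lengths. The letter $\omega$ denotes the dyadic squares of size $2^{-N}\times2^{-N}$ in $Q$; every $R\in\mathcal D_N$ is a union of such squares. A measure $\mu$ on $Q$ (at scale $N$) is a collection of non-negative numbers $\{\mu(\omega)\}_\omega$, one for each $2^{-N}\times 2^{-N}$ dyadic square; for every set $U$ that is a union of squares $\omega$ one puts $\mu(U)=\sum_{\omega\subset U}\mu(\omega)$. *)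

theory Defs
  imports "HOL-Analysis.Analysis"
begin

definition dyadic_intervals :: "real set set" where
  "dyadic_intervals =
    {{of_int j / 2 ^ n ..< (of_int j + 1) / 2 ^ n} | (j :: int) (n :: nat). True} \<inter> Pow {0..1}"

abbreviation len :: "real set \<Rightarrow> real" where
  "len I \<equiv> measure lborel I"

definition dyadic_rectangles :: "nat \<Rightarrow> (real \<times> real) set set" where
  "dyadic_rectangles N =
    {H \<times> V | H V. H \<in> dyadic_intervals \<and> V \<in> dyadic_intervals \<and>
       len H \<ge> 1 / 2 ^ N \<and> len V \<ge> 1 / 2 ^ N}"

definition dyadic_squares :: "nat \<Rightarrow> (real \<times> real) set set" where
  "dyadic_squares N =
    {H \<times> V | H V. H \<in> dyadic_intervals \<and> V \<in> dyadic_intervals \<and>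
       len H = 1 / 2 ^ N \<and> len V = 1 / 2 ^ N}"

text \<open>A measure at scale N is a choice of weights on the squares of side 2 to the power -N;
  the values of the weight function on all other sets are irrelevant.\<close>

definition dyadic_measure :: "nat \<Rightarrow> ((real \<times> real) set \<Rightarrow> real) \<Rightarrow> bool" where
  "dyadic_measure N \<mu> \<longleftrightarrow> (\<forall>\<omega>\<in>dyadic_squares N. 0 \<le> \<mu> \<omega>)"

definition mass :: "nat \<Rightarrow> ((real \<times> real) set \<Rightarrow> real) \<Rightarrow> (real \<times> real) set \<Rightarrow> real" where
  "mass N \<mu> U = (\<Sum>\<omega> | \<omega> \<in> dyadic_squares N \<and> \<omega> \<subseteq> U. \<mu> \<omega>)"

definition box_condition :: "nat \<Rightarrow> real \<Rightarrow> ((real \<times> real) set \<Rightarrow> real) \<Rightarrow> bool" where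
  "box_condition N C\<^sub>0 \<mu> \<longleftrightarrow>
    (\<forall>R\<^sub>0\<in>dyadic_rectangles N.
       (\<Sum>R | R \<in> dyadic_rectangles N \<and> R \<subseteq> R\<^sub>0. (mass N \<mu> R)\<^sup>2) \<le> C\<^sub>0 * mass N \<mu> R\<^sub>0)"

text \<open>The families are finite, so the sums above are genuine, and a single square carries
  exactly its weight.\<close>

lemma len_dyadic: "len {of_int j / 2 ^ n ..< (of_int j + 1) / 2 ^ n} = 1 / 2 ^ n"
  by (simp add: field_simps)

lemma finite_dyadic_intervals_length_ge:
  "finite {I \<in> dyadic_intervals. len I \<ge> 1 / 2 ^ N}"
proof (rule finite_subset)
  let ?f = "\<lambda>(j :: int, n :: nat). {of_int j / 2 ^ n ..< (of_int j + 1) / 2 ^ n :: real}"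
  show "finite (?f ` ({0..2 ^ N} \<times> {..N}))" by simp
  show "{I \<in> dyadic_intervals. len I \<ge> 1 / 2 ^ N} \<subseteq> ?f ` ({0..2 ^ N} \<times> {..N})"
  proof
    fix I assume "I \<in> {I \<in> dyadic_intervals. len I \<ge> 1 / 2 ^ N}"
    then obtain j n where I: "I = ?f (j, n)" and sub: "I \<subseteq> {0..1}" and len: "len I \<ge> 1 / 2 ^ N"
      by (auto simp: dyadic_intervals_def)
    have "(1 :: real) / 2 ^ N \<le> 1 / 2 ^ n"
      using len I len_dyadic by simp
    then have "(2 :: real) ^ n \<le> 2 ^ N" by (simp add: field_simps)
    then have n: "n \<le> N" by simp
    have "of_int j / 2 ^ n \<in> I" by (simp add: I divide_strict_right_mono)
    with sub have "0 \<le> of_int j / (2 :: real) ^ n" "of_int j / (2 :: real) ^ n \<le> 1" by auto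
    then have j0: "0 \<le> j" and "of_int j \<le> (2 :: real) ^ n"
      by (simp_all add: pos_le_divide_eq pos_divide_le_eq)
    then have "j \<le> 2 ^ n" by (metis of_int_le_iff of_int_numeral of_int_power)
    also have "(2 :: int) ^ n \<le> 2 ^ N" using n by (simp add: power_increasing)
    finally show "I \<in> ?f ` ({0..2 ^ N} \<times> {..N})" using I n j0 by force
  qed
qed

lemma finite_dyadic_rectangles: "finite (dyadic_rectangles N)"
proof (rule finite_subset)
  let ?A = "{I \<in> dyadic_intervals. len I \<ge> 1 / 2 ^ N}"
  show "dyadic_rectangles N \<subseteq> (\<lambda>(H, V). H \<times> V) ` (?A \<times> ?A)"
    by (auto simp: dyadic_rectangles_def)
  show "finite ((\<lambda>(H, V). H \<times> V) ` (?A \<times> ?A))"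
    using finite_dyadic_intervals_length_ge by blast
qed

lemma dyadic_squares_subset: "dyadic_squares N \<subseteq> dyadic_rectangles N"
  unfolding dyadic_squares_def dyadic_rectangles_def by fastforce

lemma finite_dyadic_squares: "finite (dyadic_squares N)"
  using finite_dyadic_rectangles dyadic_squares_subset finite_subset by blast

lemma dyadic_interval_eqI:
  assumes "I \<in> dyadic_intervals" "J \<in> dyadic_intervals" "len I = len J" "I \<subseteq> J"
  shows "I = J"
proof -
  obtain j n where I: "I = {of_int j / 2 ^ n ..< (of_int j + 1) / 2 ^ n}"
    using assms(1) by (auto simp: dyadic_intervals_def)
  obtain k m where J: "J = {of_int k / 2 ^ m ..< (of_int k + 1) / 2 ^ m}"
    using assms(2) by (auto simp: dyadic_intervals_def)
  have nm: "(1 :: real) / 2 ^ n = 1 / 2 ^ m" using assms(3) unfolding I J len_dyadic .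
  then have "(2 :: real) ^ n = 2 ^ m" by simp
  then have "n = m" by simp
  moreover have "(of_int j :: real) / 2 ^ n < (of_int j + 1) / 2 ^ n"
    by (simp add: divide_strict_right_mono)
  ultimately have "(of_int k :: real) / 2 ^ n \<le> of_int j / 2 ^ n"
    "(of_int j + 1) / 2 ^ n \<le> ((of_int k + 1) / 2 ^ n :: real)"
    using assms(4) unfolding I J by (simp_all add: ivl_subset)
  then have "j = k" by (simp add: divide_le_cancel)
  with \<open>n = m\<close> show ?thesis using I J by simp
qed

lemma mass_square:
  assumes "\<omega> \<in> dyadic_squares N"
  shows "mass N \<mu> \<omega> = \<mu> \<omega>"
proof -
  have "\<omega>' = \<omega>" if sq: "\<omega>' \<in> dyadic_squares N" and sub: "\<omega>' \<subseteq> \<omega>" for \<omega>'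
  proof -
    obtain H V where HV: "\<omega> = H \<times> V" "H \<in> dyadic_intervals" "V \<in> dyadic_intervals"
      "len H = 1 / 2 ^ N" "len V = 1 / 2 ^ N"
      using assms unfolding dyadic_squares_def by blast
    obtain H' V' where HV': "\<omega>' = H' \<times> V'" "H' \<in> dyadic_intervals" "V' \<in> dyadic_intervals"
      "len H' = 1 / 2 ^ N" "len V' = 1 / 2 ^ N"
      using sq unfolding dyadic_squares_def by blast
    have "H' \<noteq> {}" "V' \<noteq> {}" using HV'(4,5) by auto
    then have "H' \<subseteq> H" "V' \<subseteq> V" using sub HV(1) HV'(1) by auto
    then show ?thesis using HV HV' dyadic_interval_eqI by metis
  qed
  then have "{\<omega>'. \<omega>' \<in> dyadic_squares N \<and> \<omega>' \<subseteq> \<omega>} = {\<omega>}" using assms by auto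
  then show ?thesis by (simp add: mass_def)
qed

end

(* Along the dyadic ancestors H_i x V_j of R = H_h x V_v put a i j = mass (H_i x V_j). This is
   monotone under inclusion, so keeping only the ancestors between H_i x V_j and H_{i-p} x V_{j-q}
   in the box condition for the latter gives (p + 1) (q + 1) (a i j)^2 <= C0 * a (i - p) (j - q).
   With p, q about i/2, j/2 this says that the quantity M i j = (i + 1) (j + 1) a i j satisfies
   M i j^2 <= 16 C0 M (i/2) (j/2), and M <= 16 C0 follows by induction. *)
theory Submission
  imports Defs
begin

text \<open>The purely numerical core. Induction runs on the sum \<open>i + j\<close>, since halving
  leaves a coordinate equal to 0 unchanged and only the sum is sure to drop.\<close>

lemma self_improving_decay:
  fixes a :: "nat \<Rightarrow> nat \<Rightarrow> real"
  assumes C: "C \<ge> 0"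
    and box: "\<And>i j p q. i \<le> h \<Longrightarrow> j \<le> v \<Longrightarrow> p \<le> i \<Longrightarrow> q \<le> j \<Longrightarrow>
      real ((p + 1) * (q + 1)) * (a i j)\<^sup>2 \<le> C * a (i - p) (j - q)"
    and "i \<le> h" "j \<le> v"
  shows "real ((i + 1) * (j + 1)) * a i j \<le> 16 * C"
  using assms(3,4)
proof (induction "i + j" arbitrary: i j rule: less_induct)
  case less
  show ?case
  proof (cases "a i j \<le> 0 \<or> i + j = 0")
    case True
    \<comment> \<open>At the root, \<open>box\<close> with \<open>p = q = 0\<close> reads a^2 <= C
      a, and a positive a cancels.\<close>
    have "a i j \<le> C" if "i = 0" "j = 0" "a i j > 0"
      using box[of 0 0 0 0] that by (simp add: power2_eq_square)
    with True consider "a i j \<le> 0" | "i = 0" "j = 0" "a i j \<le> C" by fastforce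
    then show ?thesis
    proof cases
      case 1
      then have "real ((i + 1) * (j + 1)) * a i j \<le> 0" by (intro mult_nonneg_nonpos) auto
      with C show ?thesis by linarith
    qed (use C in simp)
  next
    case False
    \<comment> \<open>Rounding up gives \<open>p > 0\<close> whenever \<open>i > 0\<close>. Rounding
      down would give \<open>p = q = 0\<close> at the indices (1, 0), and the induction would stall
      there.\<close>
    define p q where "p = (i + 1) div 2" and "q = (j + 1) div 2"
    define m where "m = real ((i + 1) * (j + 1))"
    define s t where "s = real ((p + 1) * (q + 1))" and "t = real ((i - p + 1) * (j - q + 1))"
    have pos: "a i j > 0" "m > 0" "s > 0" "t > 0"
      using False unfolding m_def s_def t_def of_nat_0_less_iff by simp_all
    have pq: "p \<le> i" "q \<le> j" "(i - p) + (j - q) < i + j"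
      using False by (auto simp: p_def q_def)
    \<comment> \<open>Each halving loses at most a factor 2 per coordinate, hence 4 in each of
      \<open>s\<close> and \<open>t\<close>, and 16 in the comparison of \<open>m\<close> squared
      with \<open>s * t\<close>.\<close>
    have half: "i + 1 \<le> 2 * (p + 1)" "i + 1 \<le> 2 * (i - p + 1)"
      "j + 1 \<le> 2 * (q + 1)" "j + 1 \<le> 2 * (j - q + 1)"
      unfolding p_def q_def by presburger+
    have four: "2 * u * (2 * w) = 4 * (u * w)" for u w :: nat by simp
    have "(i + 1) * (j + 1) \<le> 4 * ((p + 1) * (q + 1))"
      "(i + 1) * (j + 1) \<le> 4 * ((i - p + 1) * (j - q + 1))"
      using mult_le_mono[OF half(1) half(3)] mult_le_mono[OF half(2) half(4)]
      by (simp_all only: four)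
    then have m: "m \<le> 4 * s" "m \<le> 4 * t"
      unfolding m_def s_def t_def by (metis of_nat_le_iff of_nat_mult of_nat_numeral)+
    have "s * (a i j)\<^sup>2 \<le> C * a (i - p) (j - q)"
      unfolding s_def by (rule box[OF less.prems pq(1,2)])
    \<comment> \<open>The factor \<open>t\<close> produces exactly the quantity that the induction
      hypothesis bounds at the halved indices.\<close>
    then have "s * (a i j)\<^sup>2 * t \<le> C * a (i - p) (j - q) * t"
      using pos by (intro mult_right_mono) auto
    also have "\<dots> = C * (t * a (i - p) (j - q))" by simp
    also have "\<dots> \<le> C * (16 * C)"
      unfolding t_def using less.hyps[OF pq(3)] less.prems C by (intro mult_left_mono) auto
    finally have *: "(s * t) * (a i j)\<^sup>2 \<le> 16 * C\<^sup>2" by (simp add: power2_eq_square algebra_simps)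
    have "m * m \<le> (4 * s) * (4 * t)" using m pos by (intro mult_mono) auto
    then have "m\<^sup>2 \<le> 16 * (s * t)" by (simp add: power2_eq_square)
    then have "m\<^sup>2 * (a i j)\<^sup>2 \<le> 16 * (s * t) * (a i j)\<^sup>2" by (rule mult_right_mono) simp
    \<comment> \<open>The bound K = 16 C reproduces itself because it solves K^2 = 16 C K.\<close>
    with * have "(m * a i j)\<^sup>2 \<le> (16 * C)\<^sup>2" by (simp add: power_mult_distrib)
    then show ?thesis using C unfolding m_def by (auto intro: power2_le_imp_le)
  qed
qed

text \<open>With \<open>x\<close> fixed and \<open>n\<close> varying this runs through a whole chain
  of dyadic ancestors, so ancestors are indexed by their generation alone.\<close>

definition dyadic_at :: "real \<Rightarrow> nat \<Rightarrow> real set" where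
  "dyadic_at x n = {of_int \<lfloor>2 ^ n * x\<rfloor> / 2 ^ n ..< (of_int \<lfloor>2 ^ n * x\<rfloor> + 1) / 2 ^ n}"

lemma mem_dyadic_at_iff: "y \<in> dyadic_at x n \<longleftrightarrow> \<lfloor>2 ^ n * y\<rfloor> = \<lfloor>2 ^ n * x\<rfloor>"
  by (auto simp: dyadic_at_def floor_eq_iff field_simps)

lemma len_dyadic_at: "len (dyadic_at x n) = 1 / 2 ^ n"
  unfolding dyadic_at_def by (rule len_dyadic)

text \<open>The coarse floor is an integer quotient of the fine floor, so points sharing the fine
  floor share the coarse one.\<close>

lemma dyadic_at_mono:
  assumes "k \<le> n"
  shows "dyadic_at x n \<subseteq> dyadic_at x k"
proof
  have *: "\<lfloor>2 ^ k * y\<rfloor> = \<lfloor>2 ^ n * y\<rfloor> div 2 ^ (n - k)" for y :: real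
  proof -
    have "(2 :: real) ^ n = 2 ^ k * 2 ^ (n - k)" using assms by (simp flip: power_add)
    then have "2 ^ k * y = 2 ^ n * y / real_of_int (2 ^ (n - k))" by simp
    then show ?thesis using floor_divide_real_eq_div[of "2 ^ (n - k)" "2 ^ n * y"] by simp
  qed
  fix y assume "y \<in> dyadic_at x n"
  then show "y \<in> dyadic_at x k" by (simp add: mem_dyadic_at_iff *)
qed

lemma dyadic_at_in_dyadic_intervals:
  assumes "0 \<le> x" "x < 1"
  shows "dyadic_at x n \<in> dyadic_intervals"
proof -
  have "\<lfloor>x\<rfloor> = 0" using assms by (simp add: floor_eq_iff)
  then have "dyadic_at x 0 = {0..<1}" by (simp add: dyadic_at_def)
  moreover have "dyadic_at x n \<subseteq> dyadic_at x 0" by (rule dyadic_at_mono) simp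
  ultimately have "dyadic_at x n \<subseteq> {0..1}" by auto
  then show ?thesis unfolding dyadic_intervals_def dyadic_at_def by blast
qed

lemma dyadic_interval_eq_dyadic_at:
  assumes "I \<in> dyadic_intervals"
  obtains x n where "0 \<le> x" "x < 1" "I = dyadic_at x n"
proof -
  obtain j n where I: "I = {of_int j / 2 ^ n ..< (of_int j + 1) / 2 ^ n}" and sub: "I \<subseteq> {0..1}"
    using assms by (auto simp: dyadic_intervals_def)
  define x :: real where "x = of_int j / 2 ^ n"
  \<comment> \<open>The left endpoint serves as base point. The midpoint, lying strictly to its
    right and still in the unit interval, forces \<open>x < 1\<close>.\<close>
  have "x \<in> I" "x + 1 / 2 ^ n / 2 \<in> I"
    unfolding I x_def by (auto simp: field_simps)
  with sub have "0 \<le> x" "x + 1 / 2 ^ n / 2 \<le> 1" by auto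
  moreover have "(0 :: real) < 1 / 2 ^ n / 2" by simp
  ultimately have "0 \<le> x" "x < 1" by linarith+
  moreover have "I = dyadic_at x n" by (simp add: I dyadic_at_def x_def)
  ultimately show thesis using that by blast
qed

lemma mass_mono:
  assumes "dyadic_measure N \<mu>" "U \<subseteq> W"
  shows "mass N \<mu> U \<le> mass N \<mu> W"
  unfolding mass_def
  by (rule sum_mono2) (use assms finite_dyadic_squares in \<open>auto simp: dyadic_measure_def\<close>)

lemma mass_nonneg: "dyadic_measure N \<mu> \<Longrightarrow> 0 \<le> mass N \<mu> U"
  unfolding mass_def by (rule sum_nonneg) (auto simp: dyadic_measure_def)

lemma dyadic_at_Times_eq_iff:
  "dyadic_at x i \<times> dyadic_at y j = dyadic_at x i' \<times> dyadic_at y j' \<longleftrightarrow> i = i' \<and> j = j'"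
proof
  assume "dyadic_at x i \<times> dyadic_at y j = dyadic_at x i' \<times> dyadic_at y j'"
  moreover have "x \<in> dyadic_at x i" "y \<in> dyadic_at y j" by (simp_all add: mem_dyadic_at_iff)
  ultimately have "dyadic_at x i = dyadic_at x i'" "dyadic_at y j = dyadic_at y j'"
    by (auto simp: times_eq_iff)
  then have "(1 :: real) / 2 ^ i = 1 / 2 ^ i'" "(1 :: real) / 2 ^ j = 1 / 2 ^ j'"
    by (metis len_dyadic_at)+
  then show "i = i' \<and> j = j'" by simp
qed auto

lemma box_condition_ancestors:
  assumes \<mu>: "dyadic_measure N \<mu>" "box_condition N C \<mu>"
    and x: "0 \<le> x" "x < 1" and y: "0 \<le> y" "y < 1"
    and le: "i \<le> N" "j \<le> N" "p \<le> i" "q \<le> j"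
  shows "real ((p + 1) * (q + 1)) * (mass N \<mu> (dyadic_at x i \<times> dyadic_at y j))\<^sup>2
    \<le> C * mass N \<mu> (dyadic_at x (i - p) \<times> dyadic_at y (j - q))"
proof -
  let ?R = "\<lambda>(k, l). dyadic_at x k \<times> dyadic_at y l"
  let ?B = "{i - p..i} \<times> {j - q..j}"
  have rect: "?R (k, l) \<in> dyadic_rectangles N" if "k \<le> N" "l \<le> N" for k l
    unfolding dyadic_rectangles_def
  proof (intro CollectI exI conjI)
    show "dyadic_at x k \<in> dyadic_intervals" "dyadic_at y l \<in> dyadic_intervals"
      using x y by (auto intro: dyadic_at_in_dyadic_intervals)
    show "len (dyadic_at x k) \<ge> 1 / 2 ^ N" "len (dyadic_at y l) \<ge> 1 / 2 ^ N"
      using that by (simp_all add: len_dyadic_at field_simps)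
  qed simp
  have sub: "?R (k, l) \<subseteq> ?R (k', l')" if "k' \<le> k" "l' \<le> l" for k k' l l'
    using dyadic_at_mono[OF that(1)] dyadic_at_mono[OF that(2)] by auto
  \<comment> \<open>Distinct index pairs must give distinct rectangles, since the box condition
    counts each rectangle once.\<close>
  have inj: "inj_on ?R ?B" by (auto simp: inj_on_def dyadic_at_Times_eq_iff)
  have "real ((p + 1) * (q + 1)) * (mass N \<mu> (?R (i, j)))\<^sup>2 = (\<Sum>_\<in>?B. (mass N \<mu> (?R (i, j)))\<^sup>2)"
    using le by (simp add: card_cartesian_product Suc_diff_le)
  also have "\<dots> \<le> (\<Sum>z\<in>?B. (mass N \<mu> (?R z))\<^sup>2)"
  proof (intro sum_mono power_mono mass_mono mass_nonneg \<mu>(1))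
    fix z assume "z \<in> ?B"
    then show "?R (i, j) \<subseteq> ?R z" using sub[of "fst z" i "snd z" j] by (cases z) simp
  qed
  also have "\<dots> = (\<Sum>R\<in>?R ` ?B. (mass N \<mu> R)\<^sup>2)"
    by (simp add: sum.reindex[OF inj])
  \<comment> \<open>The rectangles outside the chosen grid of ancestors only add non-negative
    squares.\<close>
  also have "\<dots> \<le> (\<Sum>R | R \<in> dyadic_rectangles N \<and> R \<subseteq> ?R (i - p, j - q). (mass N \<mu> R)\<^sup>2)"
  proof (rule sum_mono2)
    show "?R ` ?B \<subseteq> {R \<in> dyadic_rectangles N. R \<subseteq> ?R (i - p, j - q)}"
    proof (rule image_subsetI)
      fix z assume "z \<in> ?B"
      then show "?R z \<in> {R \<in> dyadic_rectangles N. R \<subseteq> ?R (i - p, j - q)}"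
        using rect[of "fst z" "snd z"] sub[of "i - p" "fst z" "j - q" "snd z"] le
        by (cases z) simp
    qed
  qed (simp_all add: finite_dyadic_rectangles)
  also have "\<dots> \<le> C * mass N \<mu> (?R (i - p, j - q))"
    using \<mu>(2) rect[of "i - p" "j - q"] le unfolding box_condition_def by simp
  finally show ?thesis by simp
qed

lemma mass_le_of_box_condition:
  assumes "dyadic_measure N \<mu>" "box_condition N C \<mu>" "C \<ge> 0"
    and "0 \<le> x" "x < 1" "0 \<le> y" "y < 1" "i \<le> N" "j \<le> N" "0 < i" "0 < j"
  shows "mass N \<mu> (dyadic_at x i \<times> dyadic_at y j) \<le> 16 * C / (real i * real j)"
proof -
  let ?a = "\<lambda>i j. mass N \<mu> (dyadic_at x i \<times> dyadic_at y j)"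
  have "real (i * j) * ?a i j \<le> real ((i + 1) * (j + 1)) * ?a i j"
    using mass_nonneg[OF assms(1)] by (intro mult_right_mono of_nat_mono mult_mono) auto
  also have "\<dots> \<le> 16 * C"
    \<comment> \<open>Generations up to \<open>N\<close> in either direction stay inside the family,
      which is why \<open>h = v = N\<close>.\<close>
    using assms by (intro self_improving_decay[where h = N and v = N] box_condition_ancestors)
  finally show ?thesis using assms by (simp add: field_simps)
qed

theorem mainTheorem2:
  fixes C\<^sub>0 :: real
  assumes "C\<^sub>0 > 0"
  shows "\<exists>C>0. \<forall>N>0. \<forall>\<mu>. dyadic_measure N \<mu> \<and> box_condition N C\<^sub>0 \<mu> \<longrightarrow>
    (\<forall>H V. H \<times> V \<in> dyadic_rectangles N \<and> len H < 1 \<and> len V < 1 \<longrightarrow>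
       mass N \<mu> (H \<times> V) \<le> C / (log 2 (1 / len H) * log 2 (1 / len V))) \<and>
    (\<forall>\<omega>\<in>dyadic_squares N. \<mu> \<omega> \<le> C / (real N)\<^sup>2)"
proof (intro exI[of _ "16 * C\<^sub>0"] conjI allI impI ballI)
  show "16 * C\<^sub>0 > 0" using assms by simp
next
  fix N :: nat and \<mu> H V
  assume \<mu>: "dyadic_measure N \<mu> \<and> box_condition N C\<^sub>0 \<mu>"
    and R: "H \<times> V \<in> dyadic_rectangles N \<and> len H < 1 \<and> len V < 1"
  obtain H' V' where HV': "H \<times> V = H' \<times> V'" "H' \<in> dyadic_intervals" "V' \<in> dyadic_intervals"
    "len H' \<ge> 1 / 2 ^ N" "len V' \<ge> 1 / 2 ^ N"
    using R unfolding dyadic_rectangles_def by blast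
  obtain x i where x: "0 \<le> x" "x < 1" "H' = dyadic_at x i"
    using HV'(2) by (rule dyadic_interval_eq_dyadic_at)
  obtain y j where y: "0 \<le> y" "y < 1" "V' = dyadic_at y j"
    using HV'(3) by (rule dyadic_interval_eq_dyadic_at)
  \<comment> \<open>Membership in the family only provides some factorization of the product;
    nonempty factors make it unique.\<close>
  have "x \<in> H'" "y \<in> V'" by (simp_all add: x y mem_dyadic_at_iff)
  with HV'(1) have eq: "H = dyadic_at x i" "V = dyadic_at y j"
    using x(3) y(3) by (auto simp: times_eq_iff)
  have "i \<le> N" "j \<le> N" using HV'(4,5) by (simp_all add: x y len_dyadic_at field_simps)
  \<comment> \<open>Generation 0 has length 1, so sides shorter than 1 have positive generation and
    the denominators are positive.\<close>
  moreover have "0 < i" "0 < j" using R by (auto simp: eq len_dyadic_at intro!: Nat.gr0I)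
  ultimately have "mass N \<mu> (H \<times> V) \<le> 16 * C\<^sub>0 / (real i * real j)"
    using mass_le_of_box_condition[of N \<mu> C\<^sub>0 x y i j] \<mu> assms x y eq by simp
  \<comment> \<open>The two logarithms are exactly the generations \<open>i\<close> and
    \<open>j\<close>.\<close>
  then show "mass N \<mu> (H \<times> V) \<le> 16 * C\<^sub>0 / (log 2 (1 / len H) * log 2 (1 / len V))"
    by (simp add: eq len_dyadic_at log_nat_power)
next
  fix N :: nat and \<mu> \<omega>
  assume N: "N > 0" and \<mu>: "dyadic_measure N \<mu> \<and> box_condition N C\<^sub>0 \<mu>"
    and \<omega>: "\<omega> \<in> dyadic_squares N"
  obtain H V where HV: "\<omega> = H \<times> V" "H \<in> dyadic_intervals" "V \<in> dyadic_intervals"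
    "len H = 1 / 2 ^ N" "len V = 1 / 2 ^ N"
    using \<omega> unfolding dyadic_squares_def by blast
  obtain x i where x: "0 \<le> x" "x < 1" "H = dyadic_at x i"
    using HV(2) by (rule dyadic_interval_eq_dyadic_at)
  obtain y j where y: "0 \<le> y" "y < 1" "V = dyadic_at y j"
    using HV(3) by (rule dyadic_interval_eq_dyadic_at)
  \<comment> \<open>A side of length 2^-N has generation \<open>N\<close>, and
    \<open>mass_square\<close> then turns the mass bound into one on the weight itself.\<close>
  have "i = N" "j = N" using HV(4,5) by (simp_all add: x y len_dyadic_at)
  then have "mass N \<mu> \<omega> \<le> 16 * C\<^sub>0 / (real N * real N)"
    using mass_le_of_box_condition[of N \<mu> C\<^sub>0 x y N N] \<mu> assms N x y HV(1) by simp
  then show "\<mu> \<omega> \<le> 16 * C\<^sub>0 / (real N)\<^sup>2"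
    by (simp add: mass_square[OF \<omega>] power2_eq_square)
qed

end
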